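(* Let $k>0$ and $\alpha>-\tfrac12$, and let $\delta,a_\pm,\chi_1,\chi_2,H_\alpha,v^+,v^-$ be as defined in the context, with $x=(0,R)$, $R>0$. Then $$v^+(x)=0,$$ while $$v^-(x)=\int_0^{a_-}e^{-Rt}\,\frac{\chi_1\bigl(\sqrt{k^2+t^2}-k\bigr)\bigl(\sqrt{k^2+t^2}-k\bigr)^\alpha}{\sqrt{k^2+t^2}}\,dt .$$ Moreover, as $R\to\infty$, $$v^-(x)=\frac{\Gamma(2\alpha+1)}{k(2k)^\alpha}R^{-(2\alpha+1)}+\mathcal O\bigl(R^{-(2\alpha+3)}\bigr).$$ In particular, the leading coefficient is nonzero, and hence $v^-(x)\neq o\bigl(R^{-(2\alpha+1)}\bigr)$.
   Context: Let $\delta\in(0,k)$ be sufficiently small (see below), $a_+=\sqrt{2k\delta-\delta^2}$ and $a_-=\sqrt{2k\delta+\delta^2}$. Let $\chi_1\in C_0^\infty(\mathbb{R})$ with $\operatorname{supp}\chi_1\subset(-\delta,\delta)$ and $\chi_1=1$ in a neighbourhood of $0$. Let $\chi_2\in C_0^\infty(\mathbb{R})$ with $\chi_2=1$ in a neighbourhood of $0$; $\delta$ is small enough that $\chi_2=1$ on $[0,a_-]$. Define $$H_\alpha(\gamma,s)=(\gamma-k)_+^\alpha\,\chi_2(s),\qquad (\gamma-k)_+^\alpha=\begin{cases}0,&\gamma\le k,\\(\gamma-k)^\alpha,&\gamma>k,\end{cases}$$ and $$v^+(x)=\int_0^{a_+}e^{iRs}\,\frac{\chi_1\bigl(\sqrt{k^2-s^2}-k\bigr)H_\alpha\bigl(\sqrt{k^2-s^2},s\bigr)}{\sqrt{k^2-s^2}}\,ds,$$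 $$v^-(x)=\int_0^{a_-}e^{-Rs}\,\frac{\chi_1\bigl(\sqrt{k^2+s^2}-k\bigr)H_\alpha\bigl(\sqrt{k^2+s^2},s\bigr)}{\sqrt{k^2+s^2}}\,ds .$$ The quantity $v=\frac{i}{4\pi}v^++\frac1{4\pi}v^-$ is the contribution near the tangency point $(k,0)$ to the outgoing solution of $-\Delta u-k^2u=f$ in $\mathbb{R}^2$ at $x=(0,R)$, with $\widehat f(\gamma,s)=\chi_1(\gamma-k)H_\alpha(\gamma,s)$. $\Gamma$ is the Gamma function. *)

theory Defs
  imports "HOL-Analysis.Analysis" "HOL-Library.Landau_Symbols"
begin

definition supp :: "(real \<Rightarrow> complex) \<Rightarrow> real set" where
  "supp f = closure {x. f x \<noteq> 0}"

definition smooth :: "(real \<Rightarrow> complex) \<Rightarrow> bool" where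
  "smooth f \<longleftrightarrow>
     (\<forall>n x. ((\<lambda>g t. vector_derivative g (at t)) ^^ n) f differentiable (at x))"

(* C_0^infinity; complex-valued, so real cutoffs are a special case. *)
definition test_function :: "(real \<Rightarrow> complex) \<Rightarrow> bool" where
  "test_function f \<longleftrightarrow> smooth f \<and> compact (supp f)"

definition a_plus :: "real \<Rightarrow> real \<Rightarrow> real" where
  "a_plus k \<delta> = sqrt (2 * k * \<delta> - \<delta>\<^sup>2)"

definition a_minus :: "real \<Rightarrow> real \<Rightarrow> real" where
  "a_minus k \<delta> = sqrt (2 * k * \<delta> + \<delta>\<^sup>2)"

(* For alpha = 0 this is the indicator function of y > 0. *)
definition pos_part_power :: "real \<Rightarrow> real \<Rightarrow> real" where
  "pos_part_power y \<alpha> = (if y \<le> 0 then 0 else y powr \<alpha>)"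

definition H :: "real \<Rightarrow> real \<Rightarrow> (real \<Rightarrow> complex) \<Rightarrow> real \<Rightarrow> real \<Rightarrow> complex" where
  "H k \<alpha> \<chi>2 \<gamma> s = of_real (pos_part_power (\<gamma> - k) \<alpha>) * \<chi>2 s"

definition v_plus_integrand ::
  "real \<Rightarrow> real \<Rightarrow> (real \<Rightarrow> complex) \<Rightarrow> (real \<Rightarrow> complex) \<Rightarrow> real \<Rightarrow> real \<Rightarrow> complex" where
  "v_plus_integrand k \<alpha> \<chi>1 \<chi>2 R s =
     exp (\<i> * of_real (R * s)) *
     (\<chi>1 (sqrt (k\<^sup>2 - s\<^sup>2) - k) * H k \<alpha> \<chi>2 (sqrt (k\<^sup>2 - s\<^sup>2)) s / of_real (sqrt (k\<^sup>2 - s\<^sup>2)))"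

definition v_minus_integrand ::
  "real \<Rightarrow> real \<Rightarrow> (real \<Rightarrow> complex) \<Rightarrow> (real \<Rightarrow> complex) \<Rightarrow> real \<Rightarrow> real \<Rightarrow> complex" where
  "v_minus_integrand k \<alpha> \<chi>1 \<chi>2 R s =
     of_real (exp (- (R * s))) *
     (\<chi>1 (sqrt (k\<^sup>2 + s\<^sup>2) - k) * H k \<alpha> \<chi>2 (sqrt (k\<^sup>2 + s\<^sup>2)) s / of_real (sqrt (k\<^sup>2 + s\<^sup>2)))"

(* v_plus and v_minus are the values at the point x = (0, R). The interval integral ranges over the
   open interval, so the value of the integrand at s = 0, where it is singular for negative alpha,
   is irrelevant. *)

definition v_plus ::
  "real \<Rightarrow> real \<Rightarrow> real \<Rightarrow> (real \<Rightarrow> complex) \<Rightarrow> (real \<Rightarrow> complex) \<Rightarrow> real \<Rightarrow> complex" where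
  "v_plus k \<alpha> \<delta> \<chi>1 \<chi>2 R =
     (LBINT s=0..ereal (a_plus k \<delta>). v_plus_integrand k \<alpha> \<chi>1 \<chi>2 R s)"

definition v_minus ::
  "real \<Rightarrow> real \<Rightarrow> real \<Rightarrow> (real \<Rightarrow> complex) \<Rightarrow> (real \<Rightarrow> complex) \<Rightarrow> real \<Rightarrow> complex" where
  "v_minus k \<alpha> \<delta> \<chi>1 \<chi>2 R =
     (LBINT s=0..ereal (a_minus k \<delta>). v_minus_integrand k \<alpha> \<chi>1 \<chi>2 R s)"

end

theory Submission
  imports Defs
begin

text \<open>
  On the real segment that defines \<open>v_plus\<close> the frequency \<open>sqrt (k\<^sup>2 - s\<^sup>2)\<close> never exceeds \<open>k\<close>, so the
  one-sided singularity \<open>(\<gamma> - k)\<^sub>+\<^sup>\<alpha>\<close> is not seen at all and the integrand vanishes identically.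

  On the evanescent side put \<open>q = sqrt (k\<^sup>2 + t\<^sup>2)\<close>. Since \<open>(q - k) (q + k) = t\<^sup>2\<close>, we have
  \<open>(q - k)\<^sup>\<alpha> = t\<^sup>2\<^sup>\<alpha> (q + k)\<^sup>-\<^sup>\<alpha>\<close> for \<open>t > 0\<close>. Hence the integrand is
  \<open>e\<^sup>-\<^sup>R\<^sup>t t\<^sup>2\<^sup>\<alpha> \<phi>(t)\<close> with the amplitude \<open>\<phi>(t) = \<chi>1 (q - k) (q + k)\<^sup>-\<^sup>\<alpha> / q\<close>.
  The amplitude is a function of \<open>t\<^sup>2\<close> and is smooth where \<open>\<chi>1 = 1\<close>; so it differs from its value
  \<open>1 / (k (2 k)\<^sup>\<alpha>)\<close> at \<open>0\<close> by \<open>O(t\<^sup>2)\<close>, with no linear term, which is why the error in the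
  expansion gains two powers of \<open>R\<close> and not one (\<open>amplitude_deviation\<close>).
  Moreover, for \<open>t > 0\<close>, \<open>q - k \<ge> \<delta>\<close> exactly when \<open>t \<ge> a_minus k \<delta>\<close>, so the cutoff makes \<open>\<phi>\<close> vanish from
  \<open>a_minus k \<delta>\<close> on and the integral may be taken over the whole half-line. There Watson's lemma, in
  the quantitative one-term form \<open>watson_leading_term\<close>, replaces \<open>\<phi>\<close> by its value at \<open>0\<close>, and the
  integral becomes a Gamma integral.
\<close>

section \<open>Laplace integrals with an algebraic singularity\<close>

lemma has_bochner_integral_laplace_powr:
  fixes R \<beta> :: real
  assumes "R > 0" "\<beta> > -1"
  shows "has_bochner_integral lborel
    (\<lambda>t. indicator {0<..} t * (exp (- (R * t)) * t powr \<beta>))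
    (Gamma (\<beta> + 1) * R powr (- (\<beta> + 1)))"
proof -
  define g :: "real \<Rightarrow> real" where "g t = indicator {0..} t * t powr \<beta> / exp t" for t
  have nn: "(\<integral>\<^sup>+t. ennreal (g t) \<partial>lborel) = ennreal (Gamma (\<beta> + 1))"
    using Gamma_conv_nn_integral_real[of "\<beta> + 1"] assms by (simp add: g_def)
  have "has_bochner_integral lborel g (Gamma (\<beta> + 1))"
  proof (rule has_bochner_integral_nn_integral[OF _ _ _ nn])
    show "g \<in> borel_measurable lborel"
      unfolding g_def by measurable
    show "AE t in lborel. 0 \<le> g t" by (simp add: g_def)
    show "0 \<le> Gamma (\<beta> + 1)" using Gamma_real_pos[of "\<beta> + 1"] assms by simp
  qed
  hence "has_bochner_integral lborel (\<lambda>t. g (0 + R * t)) (Gamma (\<beta> + 1) /\<^sub>R \<bar>R\<bar>)"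
    using assms by (subst lborel_has_bochner_integral_real_affine_iff[symmetric]) auto
  hence "has_bochner_integral lborel (\<lambda>t. R powr (-\<beta>) * g (R * t))
           (R powr (-\<beta>) * (Gamma (\<beta> + 1) /\<^sub>R \<bar>R\<bar>))"
    by (intro has_bochner_integral_mult_right) simp_all
  also have "(\<lambda>t. R powr (-\<beta>) * g (R * t)) =
      (\<lambda>t. indicator {0<..} t * (exp (- (R * t)) * t powr \<beta>))"
  proof
    fix t :: real
    show "R powr (-\<beta>) * g (R * t) = indicator {0<..} t * (exp (- (R * t)) * t powr \<beta>)"
      using assms
      by (cases t "0 :: real" rule: linorder_cases)
         (auto simp: g_def indicator_def powr_mult powr_minus exp_minus field_simps zero_le_mult_iff)
  qed
  also have "R powr (-\<beta>) * (Gamma (\<beta> + 1) /\<^sub>R \<bar>R\<bar>) = Gamma (\<beta> + 1) * R powr (- (\<beta> + 1))"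
    using assms by (simp add: powr_diff powr_minus field_simps)
  finally show ?thesis .
qed

text \<open>
  A bound on the amplitude by \<open>C t\<^sup>p\<close> is again the integrand of a Laplace integral of the same type,
  with \<open>\<beta>\<close> raised to \<open>\<beta> + p\<close>. This gives both the integrability and the error. The amplitude has to
  be controlled on the whole half-line, not only near \<open>0\<close>, so that the estimate holds for every
  \<open>R > 0\<close> without exponentially small remainders.
\<close>

lemma watson_leading_term:
  fixes \<phi> :: "real \<Rightarrow> complex" and c :: complex and C R \<beta> p :: real
  assumes R: "R > 0" and \<beta>: "\<beta> > -1" and p: "p \<ge> 0"
    and meas: "\<phi> \<in> borel_measurable borel"
    and bound: "\<And>t. t > 0 \<Longrightarrow> norm (\<phi> t - c) \<le> C * t powr p"
  shows "set_integrable lborel {0<..} (\<lambda>t. of_real (exp (- (R * t)) * t powr \<beta>) * \<phi> t)"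
    and "norm ((LBINT t:{0<..}. of_real (exp (- (R * t)) * t powr \<beta>) * \<phi> t)
           - c * of_real (Gamma (\<beta> + 1) * R powr (- (\<beta> + 1))))
         \<le> C * (Gamma (\<beta> + p + 1) * R powr (- (\<beta> + p + 1)))"
proof -
  define w :: "real \<Rightarrow> real" where "w t = indicator {0<..} t * (exp (- (R * t)) * t powr \<beta>)" for t
  define h :: "real \<Rightarrow> real"
    where "h t = C * (indicator {0<..} t * (exp (- (R * t)) * t powr (\<beta> + p)))" for t
  have w: "has_bochner_integral lborel w (Gamma (\<beta> + 1) * R powr (- (\<beta> + 1)))"
    unfolding w_def by (rule has_bochner_integral_laplace_powr[OF R \<beta>])
  have h: "has_bochner_integral lborel h (C * (Gamma (\<beta> + p + 1) * R powr (- (\<beta> + p + 1))))"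
    unfolding h_def using has_bochner_integral_laplace_powr[OF R, of "\<beta> + p"] \<beta> p
    by (intro has_bochner_integral_mult_right) auto
  have lead: "has_bochner_integral lborel (\<lambda>t. c * of_real (w t))
      (c * of_real (Gamma (\<beta> + 1) * R powr (- (\<beta> + 1))))"
    by (intro has_bochner_integral_mult_right has_bochner_integral_of_real w)
  have dom: "norm (of_real (w t) * (\<phi> t - c)) \<le> h t" for t
  proof (cases "t > 0")
    case True
    have "norm (of_real (w t) * (\<phi> t - c)) \<le> w t * (C * t powr p)"
      using True bound[OF True] unfolding norm_mult[of "of_real (w t)"]
      by (intro mult_mono) (auto simp: w_def norm_mult)
    also have "\<dots> = h t" using True by (simp add: w_def h_def powr_add)
    finally show ?thesis .
  qed (simp add: w_def h_def)
  have [measurable]: "\<phi> \<in> borel_measurable borel" "w \<in> borel_measurable borel"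
    using meas w by (auto dest: borel_measurable_has_bochner_integral)
  have rem: "integrable lborel (\<lambda>t. of_real (w t) * (\<phi> t - c))"
  proof (rule Bochner_Integration.integrable_bound)
    show "integrable lborel h" using h by (rule integrable.intros)
    show "AE t in lborel. norm (of_real (w t) * (\<phi> t - c)) \<le> norm (h t)"
      using order_trans[OF dom abs_ge_self] by simp
  qed measurable
  have full: "has_bochner_integral lborel
      (\<lambda>t. of_real (w t) * (\<phi> t - c) + c * of_real (w t))
      ((\<integral>t. of_real (w t) * (\<phi> t - c) \<partial>lborel)
        + c * of_real (Gamma (\<beta> + 1) * R powr (- (\<beta> + 1))))"
    by (intro has_bochner_integral_add lead has_bochner_integral_integrable rem)
  also have "(\<lambda>t. of_real (w t) * (\<phi> t - c) + c * of_real (w t)) =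
      (\<lambda>t. indicator {0<..} t *\<^sub>R (of_real (exp (- (R * t)) * t powr \<beta>) * \<phi> t))"
    by (auto simp: w_def algebra_simps scaleR_conv_of_real split: split_indicator)
  finally have full': "has_bochner_integral lborel
      (\<lambda>t. indicator {0<..} t *\<^sub>R (of_real (exp (- (R * t)) * t powr \<beta>) * \<phi> t))
      ((\<integral>t. of_real (w t) * (\<phi> t - c) \<partial>lborel)
        + c * of_real (Gamma (\<beta> + 1) * R powr (- (\<beta> + 1))))" .
  show "set_integrable lborel {0<..} (\<lambda>t. of_real (exp (- (R * t)) * t powr \<beta>) * \<phi> t)"
    unfolding set_integrable_def using full' by (rule integrable.intros)
  have "norm (\<integral>t. of_real (w t) * (\<phi> t - c) \<partial>lborel) \<le> (\<integral>t. h t \<partial>lborel)"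
    using h dom by (intro Bochner_Integration.integral_norm_bound_integral rem)
      (auto intro: integrable.intros)
  also have "\<dots> = C * (Gamma (\<beta> + p + 1) * R powr (- (\<beta> + p + 1)))"
    by (rule has_bochner_integral_integral_eq[OF h])
  finally show "norm ((LBINT t:{0<..}. of_real (exp (- (R * t)) * t powr \<beta>) * \<phi> t)
           - c * of_real (Gamma (\<beta> + 1) * R powr (- (\<beta> + 1))))
         \<le> C * (Gamma (\<beta> + p + 1) * R powr (- (\<beta> + p + 1)))"
    unfolding set_lebesgue_integral_def
    by (simp only: has_bochner_integral_integral_eq[OF full'] add_diff_cancel_right')
qed

section \<open>The amplitude of the evanescent integral\<close>

text \<open>
  This is the factor left over when the exponential and the singular power \<open>t\<^sup>2\<^sup>\<alpha>\<close> are split off; the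
  exponent \<open>- \<alpha>\<close> comes from \<open>q - k = t\<^sup>2 / (q + k)\<close>. Unlike the integrand, it is continuous at \<open>0\<close> for
  every \<open>\<alpha>\<close>.
\<close>

definition amplitude :: "real \<Rightarrow> real \<Rightarrow> (real \<Rightarrow> complex) \<Rightarrow> real \<Rightarrow> complex" where
  "amplitude k \<alpha> \<eta> t = \<eta> (sqrt (k\<^sup>2 + t\<^sup>2) - k)
     * of_real ((sqrt (k\<^sup>2 + t\<^sup>2) + k) powr (- \<alpha>) / sqrt (k\<^sup>2 + t\<^sup>2))"

lemma powr_sqrt_diff_factor:
  fixes k t \<alpha> :: real
  assumes "k > 0" "t > 0"
  shows "(sqrt (k\<^sup>2 + t\<^sup>2) - k) powr \<alpha> = t powr (2 * \<alpha>) * (sqrt (k\<^sup>2 + t\<^sup>2) + k) powr (- \<alpha>)"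
proof -
  define q where "q = sqrt (k\<^sup>2 + t\<^sup>2)"
  have q2: "q\<^sup>2 = k\<^sup>2 + t\<^sup>2" by (simp add: q_def)
  have "q > k" using assms unfolding q_def by (intro real_less_rsqrt) auto
  hence "(q - k) powr \<alpha> * (q + k) powr \<alpha> = ((q - k) * (q + k)) powr \<alpha>"
    using assms by (simp add: powr_mult)
  also have "(q - k) * (q + k) = t\<^sup>2"
    using q2 by (simp add: algebra_simps power2_eq_square)
  also have "t\<^sup>2 = t powr 2" using assms by simp
  finally have "(q - k) powr \<alpha> * (q + k) powr \<alpha> = t powr (2 * \<alpha>)"
    by (simp only: powr_powr)
  thus ?thesis
    using \<open>q > k\<close> assms by (simp add: powr_minus field_simps flip: q_def)
qed

lemma continuous_on_amplitude:
  assumes "k > 0" "continuous_on UNIV \<eta>"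
  shows "continuous_on UNIV (amplitude k \<alpha> \<eta>)"
proof -
  have pos: "sqrt (k\<^sup>2 + t\<^sup>2) + k \<noteq> 0" for t
    using assms by (smt (verit) real_sqrt_ge_zero sum_power2_ge_zero)
  show ?thesis
    unfolding amplitude_def
    by (intro continuous_intros continuous_on_compose2[OF assms(2)])
       (use pos assms(1) in \<open>auto simp: sum_power2_eq_zero_iff\<close>)
qed

lemma sqrt_minus_ge_of_ge_a_minus:
  assumes "k > 0" "\<delta> > 0" "t \<ge> a_minus k \<delta>"
  shows "sqrt (k\<^sup>2 + t\<^sup>2) - k \<ge> \<delta>"
proof -
  have "(a_minus k \<delta>)\<^sup>2 \<le> t\<^sup>2"
    using assms by (intro power_mono) (auto simp: a_minus_def)
  moreover have "(a_minus k \<delta>)\<^sup>2 = 2 * k * \<delta> + \<delta>\<^sup>2"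
    using assms by (simp add: a_minus_def)
  ultimately have "(k + \<delta>)\<^sup>2 \<le> k\<^sup>2 + t\<^sup>2"
    by (simp add: power2_eq_square algebra_simps)
  thus ?thesis using real_le_rsqrt by force
qed

lemma amplitude_eq_0_of_ge_a_minus:
  assumes "k > 0" "\<delta> > 0" "supp \<eta> \<subseteq> {-\<delta><..<\<delta>}" "t \<ge> a_minus k \<delta>"
  shows "amplitude k \<alpha> \<eta> t = 0"
proof -
  have "sqrt (k\<^sup>2 + t\<^sup>2) - k \<notin> supp \<eta>"
    using sqrt_minus_ge_of_ge_a_minus[OF assms(1,2,4)] assms(3) by auto
  hence "\<eta> (sqrt (k\<^sup>2 + t\<^sup>2) - k) = 0"
    unfolding supp_def using closure_subset[of "{x. \<eta> x \<noteq> 0}"] by auto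
  thus ?thesis by (simp add: amplitude_def)
qed

text \<open>
  Where the cutoff equals \<open>1\<close>, the amplitude is a differentiable function of \<open>u = t\<^sup>2\<close>, and
  differentiability at \<open>u = 0\<close> already bounds the difference by a multiple of \<open>t\<^sup>2\<close>.
\<close>

lemma amplitude_deviation_near_0:
  fixes k \<alpha> :: real
  assumes k: "k > 0" and \<eta>: "\<forall>\<^sub>F y in nhds 0. \<eta> y = 1"
  obtains C \<epsilon> where "\<epsilon> > 0"
    "\<And>t. 0 < t \<Longrightarrow> t < \<epsilon> \<Longrightarrow> norm (amplitude k \<alpha> \<eta> t - amplitude k \<alpha> \<eta> 0) \<le> C * t\<^sup>2"
proof -
  define \<psi> :: "real \<Rightarrow> real"
    where "\<psi> u = (sqrt (k\<^sup>2 + u) + k) powr (- \<alpha>) / sqrt (k\<^sup>2 + u)" for u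
  have "\<exists>D. (\<psi> has_real_derivative D) (at 0)"
    unfolding \<psi>_def using k by (intro exI) (auto intro!: derivative_eq_intros)
  then obtain D where "(\<psi> has_real_derivative D) (at 0)" ..
  hence "((\<lambda>u. (\<psi> u - \<psi> 0) / u) \<longlongrightarrow> D) (at 0)"
    by (simp add: has_field_derivative_iff)
  hence "((\<lambda>u. \<bar>(\<psi> u - \<psi> 0) / u\<bar>) \<longlongrightarrow> \<bar>D\<bar>) (at 0)"
    by (rule tendsto_rabs)
  hence ev_quot: "\<forall>\<^sub>F u in at 0. \<bar>(\<psi> u - \<psi> 0) / u\<bar> < \<bar>D\<bar> + 1"
    by (rule order_tendstoD) simp
  have sq: "filterlim (\<lambda>t :: real. t\<^sup>2) (at 0) (at_right 0)"
    by (intro filterlim_atI tendsto_eq_intros) (auto simp: eventually_at_filter)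
  have q: "((\<lambda>t. sqrt (k\<^sup>2 + t\<^sup>2) - k) \<longlongrightarrow> 0) (at_right 0)"
    using k by (auto intro!: tendsto_eq_intros)
  have "\<forall>\<^sub>F t in at_right 0. \<eta> (sqrt (k\<^sup>2 + t\<^sup>2) - k) = 1"
    using \<eta> q by (rule eventually_compose_filterlim)
  moreover have "\<forall>\<^sub>F t in at_right 0. \<bar>(\<psi> (t\<^sup>2) - \<psi> 0) / t\<^sup>2\<bar> < \<bar>D\<bar> + 1"
    using ev_quot sq by (rule eventually_compose_filterlim)
  ultimately have "\<forall>\<^sub>F t in at_right 0.
      \<eta> (sqrt (k\<^sup>2 + t\<^sup>2) - k) = 1 \<and> \<bar>(\<psi> (t\<^sup>2) - \<psi> 0) / t\<^sup>2\<bar> < \<bar>D\<bar> + 1"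
    by (rule eventually_conj)
  then obtain \<epsilon> where "\<epsilon> > 0" and \<epsilon>: "\<And>t. 0 < t \<Longrightarrow> t < \<epsilon> \<Longrightarrow>
      \<eta> (sqrt (k\<^sup>2 + t\<^sup>2) - k) = 1 \<and> \<bar>(\<psi> (t\<^sup>2) - \<psi> 0) / t\<^sup>2\<bar> < \<bar>D\<bar> + 1"
    unfolding eventually_at_right_field by auto
  have \<chi>0: "\<eta> 0 = 1" using \<eta> by (rule eventually_nhds_x_imp_x)
  show ?thesis
  proof (rule that[OF \<open>\<epsilon> > 0\<close>, of "\<bar>D\<bar> + 1"])
    fix t :: real assume t: "0 < t" "t < \<epsilon>"
    have "amplitude k \<alpha> \<eta> t - amplitude k \<alpha> \<eta> 0 = of_real (\<psi> (t\<^sup>2) - \<psi> 0)"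
      using \<epsilon>[OF t] k \<chi>0 by (simp add: amplitude_def \<psi>_def)
    hence "norm (amplitude k \<alpha> \<eta> t - amplitude k \<alpha> \<eta> 0) = \<bar>\<psi> (t\<^sup>2) - \<psi> 0\<bar>"
      by (simp only: norm_of_real)
    also have "\<dots> \<le> (\<bar>D\<bar> + 1) * t\<^sup>2"
      using \<epsilon>[OF t] t by (simp add: field_simps)
    finally show "norm (amplitude k \<alpha> \<eta> t - amplitude k \<alpha> \<eta> 0) \<le> (\<bar>D\<bar> + 1) * t\<^sup>2" .
  qed
qed

text \<open>
  Away from \<open>0\<close> the quadratic bound only asks for boundedness, since \<open>t\<^sup>2\<close> is bounded below there;
  boundedness holds because the amplitude is continuous and vanishes for large \<open>t\<close>.
\<close>

lemma amplitude_deviation: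
  fixes k \<alpha> \<delta> :: real
  assumes k: "k > 0" and \<delta>: "\<delta> > 0" and cont: "continuous_on UNIV \<eta>"
    and supp: "supp \<eta> \<subseteq> {-\<delta><..<\<delta>}" and one: "\<forall>\<^sub>F y in nhds 0. \<eta> y = 1"
  obtains C where "\<And>t. t > 0 \<Longrightarrow> norm (amplitude k \<alpha> \<eta> t - amplitude k \<alpha> \<eta> 0) \<le> C * t\<^sup>2"
proof -
  let ?d = "\<lambda>t. norm (amplitude k \<alpha> \<eta> t - amplitude k \<alpha> \<eta> 0)"
  obtain C \<epsilon> where \<epsilon>: "\<epsilon> > 0" and near: "\<And>t. 0 < t \<Longrightarrow> t < \<epsilon> \<Longrightarrow> ?d t \<le> C * t\<^sup>2"
    using amplitude_deviation_near_0[OF k one] by blast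
  have "continuous_on {0..a_minus k \<delta>} (amplitude k \<alpha> \<eta>)"
    using continuous_on_amplitude[OF k cont] by (rule continuous_on_subset) simp
  hence "bounded (amplitude k \<alpha> \<eta> ` {0..a_minus k \<delta>})"
    by (intro compact_imp_bounded compact_continuous_image) auto
  then obtain B where B: "\<And>t. 0 \<le> t \<Longrightarrow> t \<le> a_minus k \<delta> \<Longrightarrow> norm (amplitude k \<alpha> \<eta> t) \<le> B"
    unfolding bounded_iff by force
  have "a_minus k \<delta> \<ge> 0" using k \<delta> by (simp add: a_minus_def)
  hence B0: "norm (amplitude k \<alpha> \<eta> 0) \<le> B" using B[of 0] by simp
  have "B \<ge> 0" using B0 norm_ge_zero order_trans by blast
  have B': "norm (amplitude k \<alpha> \<eta> t) \<le> B" if "t > 0" for t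
    using B[of t] amplitude_eq_0_of_ge_a_minus[OF k \<delta> supp, of t \<alpha>] that
      \<open>B \<ge> 0\<close>
    by (cases "t \<le> a_minus k \<delta>") auto
  show ?thesis
  proof (rule that)
    fix t :: real assume t: "t > 0"
    show "?d t \<le> max C (2 * B / \<epsilon>\<^sup>2) * t\<^sup>2"
    proof (cases "t < \<epsilon>")
      case True
      hence "?d t \<le> C * t\<^sup>2" using near t by simp
      also have "\<dots> \<le> max C (2 * B / \<epsilon>\<^sup>2) * t\<^sup>2" by (intro mult_right_mono) auto
      finally show ?thesis .
    next
      case False
      have "?d t \<le> 2 * B"
        using norm_triangle_ineq4[of "amplitude k \<alpha> \<eta> t" "amplitude k \<alpha> \<eta> 0"] B'[OF t] B0 by linarith
      also have "\<dots> = 2 * B / \<epsilon>\<^sup>2 * \<epsilon>\<^sup>2" using \<epsilon> by simp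
      also have "\<dots> \<le> 2 * B / \<epsilon>\<^sup>2 * t\<^sup>2"
        using False \<epsilon> \<open>B \<ge> 0\<close> by (intro mult_left_mono power_mono) auto
      also have "\<dots> \<le> max C (2 * B / \<epsilon>\<^sup>2) * t\<^sup>2" by (intro mult_right_mono) auto
      finally show ?thesis .
    qed
  qed
qed

lemma test_function_continuous:
  assumes "test_function \<eta>"
  shows "continuous_on UNIV \<eta>"
proof -
  have "smooth \<eta>" using assms by (simp add: test_function_def)
  hence "\<eta> differentiable (at x)" for x
    unfolding smooth_def by (drule_tac spec[of _ 0]) auto
  thus ?thesis
    by (simp add: continuous_at_imp_continuous_on differentiable_imp_continuous_within)
qed

section \<open>The propagating and the evanescent part\<close>

lemma v_plus_integrand_eq_0:
  assumes "k > 0"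
  shows "v_plus_integrand k \<alpha> \<chi>1 \<chi>2 R = (\<lambda>s. 0)"
proof
  fix s :: real
  have "sqrt (k\<^sup>2 - s\<^sup>2) \<le> k" using assms by (intro real_le_lsqrt) auto
  thus "v_plus_integrand k \<alpha> \<chi>1 \<chi>2 R s = 0"
    by (simp add: v_plus_integrand_def H_def pos_part_power_def)
qed

lemma v_minus_integrand_eq:
  assumes "k > 0" "0 < t" "\<chi>2 t = 1"
  shows "v_minus_integrand k \<alpha> \<chi>1 \<chi>2 R t =
      of_real (exp (- (R * t))) *
        (\<chi>1 (sqrt (k\<^sup>2 + t\<^sup>2) - k) * of_real ((sqrt (k\<^sup>2 + t\<^sup>2) - k) powr \<alpha>)
          / of_real (sqrt (k\<^sup>2 + t\<^sup>2)))"
    and "v_minus_integrand k \<alpha> \<chi>1 \<chi>2 R t =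
      of_real (exp (- (R * t)) * t powr (2 * \<alpha>)) * amplitude k \<alpha> \<chi>1 t"
proof -
  have "k < sqrt (k\<^sup>2 + t\<^sup>2)" using assms by (intro real_less_rsqrt) auto
  thus *: "v_minus_integrand k \<alpha> \<chi>1 \<chi>2 R t =
      of_real (exp (- (R * t))) *
        (\<chi>1 (sqrt (k\<^sup>2 + t\<^sup>2) - k) * of_real ((sqrt (k\<^sup>2 + t\<^sup>2) - k) powr \<alpha>)
          / of_real (sqrt (k\<^sup>2 + t\<^sup>2)))"
    using assms by (simp add: v_minus_integrand_def H_def pos_part_power_def)
  show "v_minus_integrand k \<alpha> \<chi>1 \<chi>2 R t =
      of_real (exp (- (R * t)) * t powr (2 * \<alpha>)) * amplitude k \<alpha> \<chi>1 t"
    unfolding * powr_sqrt_diff_factor[OF assms(1,2)] amplitude_def by simp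
qed

text \<open>
  The amplitude vanishes beyond \<open>a_minus k \<delta>\<close>, so extending the interval of integration to the
  half-line costs nothing.
\<close>

lemma indicator_v_minus_integrand:
  assumes "k > 0" "\<delta> > 0" "supp \<chi>1 \<subseteq> {-\<delta><..<\<delta>}" "\<forall>s\<in>{0..a_minus k \<delta>}. \<chi>2 s = 1"
  shows "indicator (einterval 0 (ereal (a_minus k \<delta>))) t *\<^sub>R v_minus_integrand k \<alpha> \<chi>1 \<chi>2 R t =
    indicator {0<..} t *\<^sub>R (of_real (exp (- (R * t)) * t powr (2 * \<alpha>)) * amplitude k \<alpha> \<chi>1 t)"
proof -
  consider "t \<le> 0" | "0 < t" "t < a_minus k \<delta>" | "0 < t" "a_minus k \<delta> \<le> t" by linarith
  thus ?thesis
  proof cases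
    case 2
    thus ?thesis
      using v_minus_integrand_eq(2)[OF assms(1), of t \<chi>2] assms(4) by (simp add: einterval_iff)
  next
    case 3
    thus ?thesis
      using amplitude_eq_0_of_ge_a_minus[OF assms(1-3), of t \<alpha>] by (simp add: einterval_iff)
  qed (simp add: einterval_iff)
qed

theorem theorem3p4:
  fixes k \<alpha> \<delta> :: real and \<chi>1 \<chi>2 :: "real \<Rightarrow> complex"
  assumes k: "k > 0"
    and \<alpha>: "\<alpha> > - 1 / 2"
    and \<delta>: "0 < \<delta>" "\<delta> < k"
    and \<chi>1: "test_function \<chi>1" "supp \<chi>1 \<subseteq> {-\<delta><..<\<delta>}" "\<forall>\<^sub>F y in nhds 0. \<chi>1 y = 1"
    and \<chi>2: "test_function \<chi>2" "\<forall>\<^sub>F s in nhds 0. \<chi>2 s = 1"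
      "\<forall>s\<in>{0..a_minus k \<delta>}. \<chi>2 s = 1"
  shows
    "(\<forall>R>0.
        interval_lebesgue_integrable lborel 0 (ereal (a_plus k \<delta>)) (v_plus_integrand k \<alpha> \<chi>1 \<chi>2 R) \<and>
        v_plus k \<alpha> \<delta> \<chi>1 \<chi>2 R = 0) \<and>
     (\<forall>R>0.
        interval_lebesgue_integrable lborel 0 (ereal (a_minus k \<delta>)) (v_minus_integrand k \<alpha> \<chi>1 \<chi>2 R) \<and>
        v_minus k \<alpha> \<delta> \<chi>1 \<chi>2 R =
          (LBINT t=0..ereal (a_minus k \<delta>).
             of_real (exp (- (R * t))) *
             (\<chi>1 (sqrt (k\<^sup>2 + t\<^sup>2) - k) * of_real ((sqrt (k\<^sup>2 + t\<^sup>2) - k) powr \<alpha>)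
               / of_real (sqrt (k\<^sup>2 + t\<^sup>2))))) \<and>
     (\<lambda>R. v_minus k \<alpha> \<delta> \<chi>1 \<chi>2 R
        - of_real (Gamma (2 * \<alpha> + 1) / (k * (2 * k) powr \<alpha>) * R powr (- (2 * \<alpha> + 1))))
       \<in> O[at_top](\<lambda>R. of_real (R powr (- (2 * \<alpha> + 3)))) \<and>
     Gamma (2 * \<alpha> + 1) / (k * (2 * k) powr \<alpha>) \<noteq> 0 \<and>
     v_minus k \<alpha> \<delta> \<chi>1 \<chi>2 \<notin> o[at_top](\<lambda>R. of_real (R powr (- (2 * \<alpha> + 1))))"
proof -
  define \<phi> where "\<phi> = amplitude k \<alpha> \<chi>1"
  define L where "L = Gamma (2 * \<alpha> + 1) / (k * (2 * k) powr \<alpha>)"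
  let ?a = "ereal (a_minus k \<delta>)"
  let ?v = "v_minus k \<alpha> \<delta> \<chi>1 \<chi>2"
  have a: "0 \<le> ?a" using k \<delta> by (simp add: a_minus_def)

  have plus: "interval_lebesgue_integrable lborel 0 (ereal (a_plus k \<delta>)) (v_plus_integrand k \<alpha> \<chi>1 \<chi>2 R) \<and>
      v_plus k \<alpha> \<delta> \<chi>1 \<chi>2 R = 0" for R
    unfolding v_plus_def v_plus_integrand_eq_0[OF k]
    by (simp add: interval_lebesgue_integrable_def set_integrable_def)

  have cont: "continuous_on UNIV \<chi>1" using \<chi>1(1) by (rule test_function_continuous)
  hence meas: "\<phi> \<in> borel_measurable borel"
    unfolding \<phi>_def using continuous_on_amplitude[OF k] by (intro borel_measurable_continuous_onI)
  obtain C where C: "\<And>t. t > 0 \<Longrightarrow> norm (\<phi> t - \<phi> 0) \<le> C * t\<^sup>2"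
    unfolding \<phi>_def using amplitude_deviation[OF k \<delta>(1) cont \<chi>1(2,3)] by blast
  have bound: "norm (\<phi> t - \<phi> 0) \<le> C * t powr 2" if "t > 0" for t
    using C[OF that] that by simp
  have indic: "indicator (einterval 0 ?a) t *\<^sub>R v_minus_integrand k \<alpha> \<chi>1 \<chi>2 R t =
      indicator {0<..} t *\<^sub>R (of_real (exp (- (R * t)) * t powr (2 * \<alpha>)) * \<phi> t)" for R t
    unfolding \<phi>_def by (rule indicator_v_minus_integrand[OF k \<delta>(1) \<chi>1(2) \<chi>2(3)])
  have \<alpha>': "2 * \<alpha> > -1" using \<alpha> by simp
  have v_eq: "?v R = (LBINT t:{0<..}. of_real (exp (- (R * t)) * t powr (2 * \<alpha>)) * \<phi> t)" for R
    unfolding v_minus_def interval_lebesgue_integral_le_eq[OF a] set_lebesgue_integral_def indic ..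
  have v_integrable: "interval_lebesgue_integrable lborel 0 ?a (v_minus_integrand k \<alpha> \<chi>1 \<chi>2 R)"
    if "R > 0" for R
    using watson_leading_term(1)[OF that \<alpha>' _ meas bound] a
    unfolding interval_lebesgue_integrable_def set_integrable_def indic by simp

  have v_formula: "?v R =
      (LBINT t=0..?a. of_real (exp (- (R * t))) *
         (\<chi>1 (sqrt (k\<^sup>2 + t\<^sup>2) - k) * of_real ((sqrt (k\<^sup>2 + t\<^sup>2) - k) powr \<alpha>)
           / of_real (sqrt (k\<^sup>2 + t\<^sup>2))))" for R
    unfolding v_minus_def
  proof (rule interval_integral_cong)
    fix t assume "t \<in> einterval (min 0 ?a) (max 0 ?a)"
    hence t: "0 < t" "t < a_minus k \<delta>" using a by (auto simp: einterval_iff min_def max_def)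
    hence "\<chi>2 t = 1" using \<chi>2(3) by simp
    thus "v_minus_integrand k \<alpha> \<chi>1 \<chi>2 R t = of_real (exp (- (R * t))) *
         (\<chi>1 (sqrt (k\<^sup>2 + t\<^sup>2) - k) * of_real ((sqrt (k\<^sup>2 + t\<^sup>2) - k) powr \<alpha>)
           / of_real (sqrt (k\<^sup>2 + t\<^sup>2)))"
      by (rule v_minus_integrand_eq(1)[OF k t(1)])
  qed

  have \<phi>0: "\<phi> 0 = of_real (1 / (k * (2 * k) powr \<alpha>))"
  proof -
    have "\<chi>1 0 = 1" using \<chi>1(3) by (rule eventually_nhds_x_imp_x)
    thus ?thesis using k by (simp add: \<phi>_def amplitude_def powr_minus field_simps)
  qed
  have lead: "\<phi> 0 * of_real (Gamma (2 * \<alpha> + 1) * r) = of_real (L * r)" for r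
    by (simp add: \<phi>0 L_def)
  have expansion: "(\<lambda>R. ?v R - of_real (L * R powr (- (2 * \<alpha> + 1))))
      \<in> O[at_top](\<lambda>R. of_real (R powr (- (2 * \<alpha> + 3))))"
  proof (rule bigoI[of _ "C * Gamma (2 * \<alpha> + 3)"])
    show "\<forall>\<^sub>F R in at_top. norm (?v R - of_real (L * R powr (- (2 * \<alpha> + 1))))
        \<le> C * Gamma (2 * \<alpha> + 3) * norm (complex_of_real (R powr (- (2 * \<alpha> + 3))))"
      using eventually_gt_at_top[of 0]
    proof eventually_elim
      case (elim R)
      show ?case
        using watson_leading_term(2)[OF elim \<alpha>' _ meas bound]
        unfolding v_eq lead by (simp add: add.assoc mult.assoc)
    qed
  qed

  have "Gamma (2 * \<alpha> + 1) > 0" using \<alpha>' by (intro Gamma_real_pos) simp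
  hence L: "L \<noteq> 0" using k by (simp add: L_def)

  have "?v \<notin> o[at_top](\<lambda>R. of_real (R powr (- (2 * \<alpha> + 1))))"
  proof
    \<comment> \<open>Otherwise the leading term, as the difference of two small terms, would be small compared
      with itself.\<close>
    let ?g = "\<lambda>R. complex_of_real (R powr (- (2 * \<alpha> + 1)))"
    assume small: "?v \<in> o[at_top](?g)"
    have "(\<lambda>R::real. R powr (- (2 * \<alpha> + 3))) \<in> o[at_top](\<lambda>R. R powr (- (2 * \<alpha> + 1)))"
      by (subst powr_smallo_iff) (auto simp: filterlim_ident)
    hence "(\<lambda>R. complex_of_real (R powr (- (2 * \<alpha> + 3)))) \<in> o[at_top](?g)"
      by (simp add: landau_o.small.of_real_iff)
    with expansion have "(\<lambda>R. ?v R - of_real (L * R powr (- (2 * \<alpha> + 1)))) \<in> o[at_top](?g)"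
      by (rule landau_o.big_small_trans)
    from sum_in_smallo(2)[OF small this]
    have "(\<lambda>R. of_real L * ?g R) \<in> o[at_top](?g)" by simp
    hence "?g \<in> o[at_top](?g)" using L by simp
    moreover have "\<forall>\<^sub>F R in at_top. ?g R \<noteq> 0"
      using eventually_gt_at_top[of 0] by eventually_elim simp
    ultimately have "\<forall>\<^sub>F R :: real in at_top. False"
      unfolding landau_o.small_refl_iff by eventually_elim simp
    thus False by simp
  qed
  with plus v_integrable v_formula expansion L show ?thesis
    unfolding L_def by blast
qed

end
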